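(* Let $m,n\ge 1$ and $q_1,\dots,q_n\in(0,1)$. Let $W=(w_{ij})_{i,j\ge1}$ be a random matrix with independent entries, where $w_{ij}$ is geometrically distributed with parameter $q_j$, i.e. $\mathrm{Prob}(w_{ij}=k)=(1-q_j)q_j^k$ for $k\in\mathbb{N}=\{0,1,2,\dots\}$ (in particular only $q_1,\dots,q_n$ matter for the columns $1,\dots,n$). Define the last-passage times $$G(a,b):=\max_{\Pi:(1,1)\to(a,b)}\sum_{(i,j)\in\Pi}w_{ij},$$ the maximum over directed lattice paths $\Pi$ from $(1,1)$ to $(a,b)$ using only steps $(i,j)\to(i+1,j)$ and $(i,j)\to(i,j+1)$. Then for every $\lambda=(\lambda_1,\dots,\lambda_m)\in\mathbb{N}^m$ with $\lambda_1\ge\cdots\ge\lambda_m\ge0$, $$\mathrm{Prob}\big(G(m,n)=\lambda_1,\,G(m-1,n)=\lambda_2,\dots,\,G(1,n)=\lambda_m\big)=\prod_{i=1}^n(1-q_i)^m\,g_\lambda(q_1,\dots,q_n).$$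
   Context: A plane partition is a matrix $\pi=(\pi_{ij})_{i,j\ge1}$ of nonnegative integers with finitely many nonzero entries such that $\pi_{ij}\ge\pi_{i+1,j}$ and $\pi_{ij}\ge\pi_{i,j+1}$ for all $i,j$. Its shape is $\mathrm{sh}(\pi)=\{(i,j):\pi_{ij}>0\}$, identified with the integer partition whose $k$-th part is the number of positive entries in row $k$. The dual Grothendieck polynomial is $$g_\lambda(x_1,\dots,x_n):=\sum_{\pi:\ \mathrm{sh}(\pi)=\lambda}\prod_{i=1}^n x_i^{c_i(\pi)},$$ the sum over plane partitions $\pi$ of shape $\lambda$ with largest entry at most $n$, where $c_i(\pi)$ is the number of columns of $\pi$ containing the entry $i$. *)

theory Defs
  imports "HOL-Probability.Probability"
begin

text \<open>All matrices are indexed from 1. A matrix is a function on \<^typ>\<open>nat\<close> in both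
  arguments; a plane partition is required to vanish at index 0 so that it is determined by
  its entries with indices at least 1.\<close>

definition plane_partition :: "(nat \<Rightarrow> nat \<Rightarrow> nat) \<Rightarrow> bool" where
  "plane_partition \<pi> \<longleftrightarrow>
     (\<forall>i j. i = 0 \<or> j = 0 \<longrightarrow> \<pi> i j = 0) \<and>
     finite {(i, j). \<pi> i j \<noteq> 0} \<and>
     (\<forall>i\<ge>1. \<forall>j\<ge>1. \<pi> i j \<ge> \<pi> (i + 1) j \<and> \<pi> i j \<ge> \<pi> i (j + 1))"

definition pp_shape :: "(nat \<Rightarrow> nat \<Rightarrow> nat) \<Rightarrow> (nat \<times> nat) set" where
  "pp_shape \<pi> = {(i, j). i \<ge> 1 \<and> j \<ge> 1 \<and> \<pi> i j > 0}"

text \<open>The list \<open>lam\<close> is the partition \<open>(\<lambda>\<^sub>1, \<dots>, \<lambda>\<^sub>m)\<close>, possibly with trailing zeros;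
  parts beyond the length of the list are 0.\<close>

definition row_part :: "nat list \<Rightarrow> nat \<Rightarrow> nat" where
  "row_part lam k = (if 1 \<le> k \<and> k \<le> length lam then lam ! (k - 1) else 0)"

definition has_shape :: "(nat \<Rightarrow> nat \<Rightarrow> nat) \<Rightarrow> nat list \<Rightarrow> bool" where
  "has_shape \<pi> lam \<longleftrightarrow> (\<forall>k\<ge>1. card {j. (k, j) \<in> pp_shape \<pi>} = row_part lam k)"

definition col_count :: "nat \<Rightarrow> (nat \<Rightarrow> nat \<Rightarrow> nat) \<Rightarrow> nat" where
  "col_count v \<pi> = card {j. j \<ge> 1 \<and> (\<exists>i\<ge>1. \<pi> i j = v)}"

definition pp_of_shape :: "nat \<Rightarrow> nat list \<Rightarrow> (nat \<Rightarrow> nat \<Rightarrow> nat) set" where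
  "pp_of_shape n lam =
     {\<pi>. plane_partition \<pi> \<and> has_shape \<pi> lam \<and> (\<forall>i\<ge>1. \<forall>j\<ge>1. \<pi> i j \<le> n)}"

definition dual_grothendieck :: "nat \<Rightarrow> nat list \<Rightarrow> (nat \<Rightarrow> 'a) \<Rightarrow> 'a::comm_semiring_1" where
  "dual_grothendieck n lam x = (\<Sum>\<pi>\<in>pp_of_shape n lam. \<Prod>i=1..n. x i ^ col_count i \<pi>)"

definition lattice_step :: "nat \<times> nat \<Rightarrow> nat \<times> nat \<Rightarrow> bool" where
  "lattice_step p r \<longleftrightarrow> r = (fst p + 1, snd p) \<or> r = (fst p, snd p + 1)"

definition lattice_paths :: "nat \<times> nat \<Rightarrow> nat \<times> nat \<Rightarrow> (nat \<times> nat) list set" where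
  "lattice_paths p r =
     {P. P \<noteq> [] \<and> hd P = p \<and> last P = r \<and> successively lattice_step P}"

definition last_passage :: "(nat \<Rightarrow> nat \<Rightarrow> nat) \<Rightarrow> nat \<Rightarrow> nat \<Rightarrow> nat" where
  "last_passage w a b =
     Max ((\<lambda>P. \<Sum>(i, j)\<leftarrow>P. w i j) ` lattice_paths (1, 1) (a, b))"

text \<open>The sum and the maximum above range over finite sets, and the latter is nonempty.\<close>

lemma row_initial:
  assumes "plane_partition \<pi>" "i \<ge> 1" "1 \<le> j'" "j' \<le> j"
  shows "\<pi> i j \<le> \<pi> i j'"
  using assms(4)
proof (induction j rule: dec_induct)
  case (step j)
  then show ?case using assms unfolding plane_partition_def
    by (metis Suc_eq_plus1 le_trans)
qed simp

lemma finite_pp_of_shape: "finite (pp_of_shape n lam)"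
proof -
  define A where "A = {1..length lam} \<times> {1..sum_list lam}"
  have supp: "(i, j) \<in> A" if \<pi>: "\<pi> \<in> pp_of_shape n lam" and nz: "\<pi> i j \<noteq> 0" for \<pi> i j
  proof -
    have pp: "plane_partition \<pi>" and sh: "has_shape \<pi> lam"
      using \<pi> by (auto simp: pp_of_shape_def)
    have ij: "i \<ge> 1" "j \<ge> 1"
      using pp nz unfolding plane_partition_def by (metis less_one not_le)+
    have fin: "finite {j. (i, j) \<in> pp_shape \<pi>}"
    proof (rule finite_subset)
      show "{j. (i, j) \<in> pp_shape \<pi>} \<subseteq> snd ` {(i, j). \<pi> i j \<noteq> 0}"
        by (force simp: pp_shape_def)
      show "finite (snd ` {(i, j). \<pi> i j \<noteq> 0})"
        using pp unfolding plane_partition_def by blast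
    qed
    have "{1..j} \<subseteq> {j. (i, j) \<in> pp_shape \<pi>}"
      using row_initial[OF pp ij(1)] nz ij by (fastforce simp: pp_shape_def)
    from card_mono[OF fin this] have le: "j \<le> row_part lam i"
      using sh ij by (simp add: has_shape_def)
    then have i: "i \<le> length lam" using ij by (auto simp: row_part_def split: if_splits)
    then have "row_part lam i \<le> sum_list lam"
      using ij by (auto simp: row_part_def intro!: member_le_sum_list)
    then show ?thesis using le i ij by (simp add: A_def)
  qed
  let ?F = "{f. \<forall>p. (p \<in> A \<longrightarrow> f p \<in> {..n}) \<and> (p \<notin> A \<longrightarrow> f p = (0::nat))}"
  have "case_prod ` pp_of_shape n lam \<subseteq> ?F"
  proof (clarsimp, intro conjI impI)
    fix \<pi> i j assume \<pi>: "\<pi> \<in> pp_of_shape n lam"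
    show "\<pi> i j \<le> n" if "(i, j) \<in> A"
      using that \<pi> by (simp add: pp_of_shape_def A_def)
    show "\<pi> i j = 0" if "(i, j) \<notin> A"
      using supp[OF \<pi>] that by blast
  qed
  moreover have "finite ?F"
    by (rule finite_set_of_finite_funs) (auto simp: A_def)
  ultimately have "finite (case_prod ` pp_of_shape n lam)" by (rule finite_subset)
  moreover have "inj_on (case_prod :: (nat \<Rightarrow> nat \<Rightarrow> nat) \<Rightarrow> _) (pp_of_shape n lam)"
    by (rule inj_onI) (metis curry_case_prod)
  ultimately show ?thesis by (rule finite_imageD)
qed

lemma lattice_paths_bounds:
  assumes "P \<noteq> []" "successively lattice_step P"
  shows "set P \<subseteq> {..fst (last P)} \<times> {..snd (last P)} \<and>
         length P + fst (hd P) + snd (hd P) = fst (last P) + snd (last P) + 1"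
  using assms
proof (induction P rule: list_nonempty_induct)
  case (single x)
  then show ?case by (cases x) auto
next
  case (cons x xs)
  then have st: "lattice_step x (hd xs)" and s: "successively lattice_step xs"
    by (auto simp: successively_Cons)
  have "hd xs \<in> {..fst (last xs)} \<times> {..snd (last xs)}"
    using cons.IH[OF s] cons.hyps by auto
  with cons.IH[OF s] st cons.hyps show ?case
    by (cases x) (auto simp: lattice_step_def)
qed

lemma finite_lattice_paths: "finite (lattice_paths p r)"
proof (rule finite_subset)
  show "lattice_paths p r \<subseteq>
      {P. set P \<subseteq> {..fst r} \<times> {..snd r} \<and> length P \<le> fst r + snd r + 1}"
    using lattice_paths_bounds by (fastforce simp: lattice_paths_def)
  show "finite {P. set P \<subseteq> {..fst r} \<times> {..snd r} \<and> length P \<le> fst r + snd r + 1}"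
    by (rule finite_lists_length_le) auto
qed

lemma lattice_paths_extend:
  assumes "lattice_paths p r \<noteq> {}" "lattice_step r s"
  shows "lattice_paths p s \<noteq> {}"
proof -
  obtain P where "P \<in> lattice_paths p r" using assms by blast
  then have "P @ [s] \<in> lattice_paths p s"
    using assms(2) by (auto simp: lattice_paths_def successively_append_iff)
  then show ?thesis by blast
qed

lemma lattice_paths_nonempty:
  assumes "a \<ge> 1" "b \<ge> 1"
  shows "lattice_paths (1, 1) (a, b) \<noteq> {}"
  using assms(2)
proof (induction b rule: dec_induct)
  case base
  show ?case using assms(1)
  proof (induction a rule: dec_induct)
    case base
    have "[(1, 1)] \<in> lattice_paths (1, 1) (1, 1)" by (simp add: lattice_paths_def)
    then show ?case by blast
  next
    case (step a)
    show ?case by (rule lattice_paths_extend[OF step.IH]) (simp add: lattice_step_def)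
  qed
next
  case (step b)
  show ?case by (rule lattice_paths_extend[OF step.IH]) (simp add: lattice_step_def)
qed

end

theory Submission
  imports Defs
begin

text \<open>
  Write the vector of passage times to column \<open>k\<close> as a partition, last row first. Adding one
  column of weights turns a partition \<open>\<mu>\<close> into \<open>\<lambda> \<supseteq> \<mu>\<close>, the weights are determined by the pair,
  and their sum is the number of columns meeting the skew shape \<open>\<lambda>/\<mu>\<close>. Hence the law of the
  passage times is a sum over chains of partitions in which the variable \<open>q\<^sub>n\<close> belongs to the
  outermost skew shape. Removing the entries 1 from a plane partition gives the same branching
  for \<open>g\<^sub>\<lambda>\<close>, except that now \<open>q\<^sub>1\<close> belongs to the outermost skew shape. The two sums therefore
  agree up to reversing the variables, and it remains to see that the sum is symmetric.

  For adjacent variables, symmetry is the interchangeability of two consecutive columns \<open>y\<close>, \<open>x\<close>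
  of weights. Read the rows in order and match each unit of \<open>x\<close> with a later unit of \<open>y\<close>, as
  brackets. The numbers of units per row and of matches per row determine the effect of
  both columns on any partition. With these numbers fixed the unmatched units form a word
  \<open>y\<^sup>p x\<^sup>r\<close> with \<open>p + r\<close> fixed, and replacing it by \<open>y\<^sup>r x\<^sup>p\<close> swaps the column sums.
\<close>

subsection \<open>Adding a column of weights\<close>

text \<open>The value 0 on the empty list stands both for the part after the last one and for the
  passage time in row 0.\<close>

fun head_part :: "nat list \<Rightarrow> nat" where
  "head_part [] = 0"
| "head_part (l # ls) = l"

text \<open>With the last row first, this is the recursion G(a,k+1) = w + max(G(a-1,k+1), G(a,k))
  for a whole column. The function \<open>increments\<close> solves it for the weights.\<close>

fun add_column :: "nat list \<Rightarrow> nat list \<Rightarrow> nat list" where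
  "add_column (y # ys) (v # vs) = (y + max (head_part (add_column ys vs)) v) # add_column ys vs"
| "add_column _ _ = []"

fun increments :: "nat list \<Rightarrow> nat list \<Rightarrow> nat list" where
  "increments (l # ls) (v # vs) = (l - max (head_part ls) v) # increments ls vs"
| "increments _ _ = []"

lemma sorted_Cons_head: "sorted_wrt (\<ge>) (l # ls) \<longleftrightarrow> head_part ls \<le> l \<and> sorted_wrt (\<ge>) ls"
  by (cases ls) auto

lemma length_add_column [simp]: "length (add_column w v) = min (length w) (length v)"
  by (induction w v rule: add_column.induct) auto

lemma length_increments [simp]: "length (increments w v) = min (length w) (length v)"
  by (induction w v rule: increments.induct) auto

lemma sorted_add_column: "sorted_wrt (\<ge>) (add_column w v)"
  by (induction w v rule: add_column.induct) (auto simp: sorted_Cons_head simp del: sorted_wrt.simps(2))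

lemma le_add_column: "length w = length v \<Longrightarrow> list_all2 (\<le>) v (add_column w v)"
  by (induction w v rule: add_column.induct) auto

lemma increments_add_column: "length w = length v \<Longrightarrow> increments (add_column w v) v = w"
  by (induction w v rule: add_column.induct) auto

text \<open>Both hypotheses make the truncated subtractions exact. With the three lemmas before,
  weight lists correspond bijectively to the weakly decreasing \<open>l\<close> entrywise above
  \<open>v\<close>.\<close>

lemma add_column_increments:
  "list_all2 (\<le>) v l \<Longrightarrow> sorted_wrt (\<ge>) l \<Longrightarrow> add_column (increments l v) v = l"
proof (induction l v rule: increments.induct)
  case (1 l ls v vs)
  then have "add_column (increments ls vs) vs = ls" by simp
  moreover have "head_part ls \<le> l" "v \<le> l"
    using 1(2,3) by (simp_all only: sorted_Cons_head list_all2_Cons)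
  ultimately show ?case by simp
qed auto

subsection \<open>Interchanging two columns\<close>

text \<open>
  A pair of columns is a list of rows \<open>(y, x)\<close>, latest row first. It is encoded by the list of
  \<open>(s, k)\<close>, where \<open>s = y + x\<close> and \<open>k\<close> is the number of units of this \<open>y\<close> matched with units
  of \<open>x\<close> in earlier rows, together with the number \<open>p\<close> of unmatched units of \<open>y\<close>.
\<close>

fun unmatched :: "(nat \<times> nat) list \<Rightarrow> nat" where
  "unmatched [] = 0"
| "unmatched ((s, k) # d) = unmatched d + s - 2 * k"

fun matched :: "(nat \<times> nat) list \<Rightarrow> nat" where
  "matched [] = 0"
| "matched ((s, k) # d) = matched d + k"

text \<open>A match uses one unit of the current row and one unmatched unit of an earlier row; the
  two bounds keep the subtraction in \<open>unmatched\<close> exact.\<close>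

fun admissible :: "(nat \<times> nat) list \<Rightarrow> bool" where
  "admissible [] = True"
| "admissible ((s, k) # d) \<longleftrightarrow> admissible d \<and> k \<le> s \<and> k \<le> unmatched d"

text \<open>The units of x still free in earlier rows number \<open>unmatched d - p\<close>, and the
  new units of y close as many of them as possible.\<close>

fun encode :: "(nat \<times> nat) list \<Rightarrow> (nat \<times> nat) list \<times> nat" where
  "encode [] = ([], 0)"
| "encode ((y, x) # r) = (let (d, p) = encode r; k = min (unmatched d - p) y
     in ((y + x, k) # d, p + y - k))"

text \<open>Unmatched units of y precede those of x, so the \<open>p\<close> units of y first fill
  the \<open>unmatched d - k\<close> free places of earlier rows. The rest lie in this row, beside
  the \<open>k\<close> matched ones.\<close>

fun decode :: "(nat \<times> nat) list \<Rightarrow> nat \<Rightarrow> (nat \<times> nat) list" where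
  "decode [] p = []"
| "decode ((s, k) # d) p = (let p' = min p (unmatched d - k); y = p - p' + k
     in (y, s - y) # decode d p')"

text \<open>If some unmatched y lies in this row, the earlier rows offer exactly \<open>k\<close>
  free units of x; otherwise this row has exactly \<open>k\<close> units of y. Either way greedy
  matching finds \<open>k\<close> again.\<close>

lemma encode_decode:
  "admissible d \<Longrightarrow> p \<le> unmatched d \<Longrightarrow> encode (decode d p) = (d, p)"
proof (induction d arbitrary: p)
  case (Cons a d)
  obtain s k where a: "a = (s, k)" by (cases a)
  define p' where "p' = min p (unmatched d - k)"
  have e: "encode (decode d p') = (d, p')"
    using Cons a by (simp add: p'_def)
  have k: "k \<le> s" "k \<le> unmatched d" "p \<le> unmatched d + s - 2 * k" using Cons.prems a by auto
  have m: "min (unmatched d - p') (p + k - p') = k" using k unfolding p'_def by linarith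
  have "p - p' + k \<le> s" "p' \<le> p" using k by (auto simp: p'_def)
  then show ?case by (simp add: a Let_def e m flip: p'_def)
qed auto

lemma decode_encode:
  "encode r = (d, p) \<Longrightarrow> decode d p = r \<and> admissible d \<and> p \<le> unmatched d"
proof (induction r arbitrary: d p)
  case (Cons a r)
  obtain y x where a: "a = (y, x)" by (cases a)
  obtain d' p' where e: "encode r = (d', p')" by (cases "encode r")
  note IH = Cons.IH[OF e]
  define k where "k = min (unmatched d' - p') y"
  have d: "d = (y + x, k) # d'" and p: "p = p' + y - k"
    using Cons.prems a e by (auto simp: k_def Let_def)
  have m: "min p (unmatched d' - k) = p'" using IH unfolding p k_def by auto
  have "p - p' + k = y" unfolding p k_def by auto
  moreover have "k \<le> unmatched d'" "k \<le> y" by (auto simp: k_def)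
  moreover have "p \<le> unmatched d' + (y + x) - 2 * k" using IH unfolding p k_def by auto
  ultimately show ?case using IH a m by (auto simp: d Let_def)
qed auto

lemma length_decode [simp]: "length (decode d p) = length d"
  by (induction d p rule: decode.induct) (auto simp: Let_def)

text \<open>A match contributes one unit to each column. Hence replacing \<open>p\<close> by
  \<open>unmatched d - p\<close> exchanges the column sums.\<close>

lemma sum_decode:
  "admissible d \<Longrightarrow> p \<le> unmatched d \<Longrightarrow>
     sum_list (map fst (decode d p)) = p + matched d \<and>
     sum_list (map snd (decode d p)) = unmatched d - p + matched d"
proof (induction d arbitrary: p)
  case (Cons a d)
  obtain s k where a: "a = (s, k)" by (cases a)
  show ?case using Cons.prems Cons.IH[of "min p (unmatched d - k)"] a
    by (auto simp: Let_def min_def)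
qed auto

section \<open>The effect of a bracketed pair of columns on a partition\<close>

fun fibre_mid :: "(nat \<times> nat) list \<Rightarrow> nat list \<Rightarrow> nat" where
  "fibre_mid ((s, k) # d) (v # vs) = k + max (fibre_mid d vs) v"
| "fibre_mid _ _ = 0"

text \<open>The outcome for \<open>p = 0\<close>: the rows of \<open>decode d 0\<close> are
  \<open>(k, s - k)\<close>, and \<open>fibre_mid\<close> is the first part after adding the column
  of the \<open>k\<close> alone.\<close>

fun fibre_out :: "(nat \<times> nat) list \<Rightarrow> nat list \<Rightarrow> nat list" where
  "fibre_out ((s, k) # d) (v # vs) =
     (s - k + max (head_part (fibre_out d vs)) (fibre_mid ((s, k) # d) (v # vs))) # fibre_out d vs"
| "fibre_out _ _ = []"

text \<open>
  The result of adding both columns does not depend on \<open>p\<close>. The induction needs to know how the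
  intermediate partition does: its first part is the maximum of a constant and
  \<open>\<lambda>\<^sub>1 - r\<close>, where \<open>r\<close> is the number of unmatched units of \<open>x\<close>.
\<close>

lemma add_two_columns_decode:
  assumes "admissible d" "p \<le> unmatched d" "length d = length v"
  defines "r \<equiv> decode d p"
  shows "add_column (map snd r) (add_column (map fst r) v) = fibre_out d v \<and>
     unmatched d \<le> head_part (fibre_out d v) \<and>
     head_part (add_column (map fst r) v)
       = max (fibre_mid d v) (head_part (fibre_out d v) - (unmatched d - p))"
  using assms(1-3) unfolding r_def
proof (induction d arbitrary: p v)
  case Nil
  then show ?case by simp
next
  case (Cons a d)
  obtain s k where a: "a = (s, k)" by (cases a)
  obtain u vs where v: "v = u # vs" using Cons.prems by (cases v) auto
  define p' where "p' = min p (unmatched d - k)"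
  define y where "y = p - p' + k"
  have pr: "admissible d" "p' \<le> unmatched d" "length d = length vs" 
    and k: "k \<le> s" "k \<le> unmatched d" "p \<le> unmatched d + s - 2 * k"
    using Cons.prems a v by (auto simp: p'_def)
  define mu where "mu = add_column (map fst (decode d p')) vs"
  define out where "out = fibre_out d vs"
  define C where "C = fibre_mid d vs"
  have IH: "add_column (map snd (decode d p')) mu = out" "unmatched d \<le> head_part out"
      "head_part mu = max C (head_part out - (unmatched d - p'))"
    using Cons.IH[OF pr] by (auto simp: mu_def out_def C_def)
  have dec: "decode (a # d) p = (y, s - y) # decode d p'" 
    by (simp add: a Let_def p'_def y_def)
  have ys: "y \<le> s" using k by (auto simp: y_def p'_def)
  have mu': "add_column (map fst ((y, s - y) # decode d p')) v = (y + max (head_part mu) u) # mu"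
    by (simp add: v mu_def)
  \<comment> \<open>The differences \<open>e\<close>, \<open>t\<close>, \<open>z\<close> replace
    truncated subtractions by sums, leaving identities between maxima.\<close>
  obtain e where e: "head_part out = unmatched d + e" using IH(2) le_Suc_ex by blast
  obtain t where t: "unmatched d = k + t" using k(2) le_Suc_ex by blast
  obtain z where z: "s = k + z" using k(1) le_Suc_ex by blast
  have "s - y + max (head_part out) (y + max (head_part mu) u)
        = s - k + max (head_part out) (k + max C u) \<and>
      y + max (head_part mu) u = max (k + max C u)
        (s - k + max (head_part out) (k + max C u) - (unmatched d + s - 2 * k - p))"
  \<comment> \<open>Earlier rows retain \<open>t\<close> unmatched units. For \<open>p <= t\<close>
    they hold all unmatched y; otherwise they retain only y, and the excess \<open>g\<close> lies in
    this row.\<close>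
  proof (cases "p \<le> t")
    case True
    then obtain g where g: "t = p + g" using le_Suc_ex by blast
    have "y = k" "p' = p" using g t by (auto simp: y_def p'_def)
    then have mu: "head_part mu = max C (e + p)" using IH(3) e t g by simp
    show ?thesis unfolding \<open>y = k\<close> mu e t z g by (auto simp: max_def)
  next
    case False
    then obtain g where g: "p = t + g" using le_Suc_ex nat_le_linear by blast
    then obtain h where h: "z = g + h" using k(3) t z le_Suc_ex[of g z] by auto
    have y: "y = g + k" and "p' = t" using g t by (auto simp: y_def p'_def)
    then have mu: "head_part mu = max C (e + t)" using IH(3) e t by simp
    show ?thesis unfolding y mu e t z h g by (simp add: max_def)
  qed
  moreover have "unmatched d + s - 2 * k \<le> s - k + max (head_part out) (k + max C u)"
    unfolding e t z by (simp add: max_def)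
  ultimately have *: "s - y + max (head_part out) (y + max (head_part mu) u)
        = s - k + max (head_part out) (k + max C u)"
      "unmatched d + s - 2 * k \<le> s - k + max (head_part out) (k + max C u)"
      "y + max (head_part mu) u = max (k + max C u)
        (s - k + max (head_part out) (k + max C u) - (unmatched d + s - 2 * k - p))"
    by blast+
  have out': "fibre_out (a # d) v = (s - k + max (head_part out) (k + max C u)) # out"
    and mid': "fibre_mid (a # d) v = k + max C u"
    by (auto simp: a v out_def C_def)
  show ?case
    unfolding dec mu' out' mid'
    by (intro conjI; (simp add: IH(1) *(1))?) (use *(2,3) in \<open>simp_all add: a\<close>)
qed

text \<open>This is the reflection operator of the bracketing rule for crystals.\<close>

definition swap_columns :: "(nat \<times> nat) list \<Rightarrow> (nat \<times> nat) list" where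
  "swap_columns r = (let (d, p) = encode r in decode d (unmatched d - p))"

lemma length_encode: "length (fst (encode r)) = length r"
  by (induction r rule: encode.induct) (auto simp: Let_def split: prod.splits)

text \<open>Only \<open>p\<close> changes, to \<open>unmatched d - p\<close>, which is an
  involution. The sums follow from \<open>sum_decode\<close>, and by
  \<open>add_two_columns_decode\<close> the final partition depends on \<open>d\<close> and
  \<open>v\<close> alone.\<close>

lemma swap_columns:
  shows length_swap_columns: "length (swap_columns r) = length r"
    and swap_columns_swap_columns: "swap_columns (swap_columns r) = r"
    and sum_fst_swap_columns: "sum_list (map fst (swap_columns r)) = sum_list (map snd r)"
    and sum_snd_swap_columns: "sum_list (map snd (swap_columns r)) = sum_list (map fst r)"
    and add_column_swap_columns: "length r = length v \<Longrightarrow>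
      add_column (map snd (swap_columns r)) (add_column (map fst (swap_columns r)) v)
      = add_column (map snd r) (add_column (map fst r) v)"
proof -
  obtain d p where e: "encode r = (d, p)" by (cases "encode r")
  then have D: "decode d p = r" "admissible d" "p \<le> unmatched d" using decode_encode by auto
  have s: "swap_columns r = decode d (unmatched d - p)" by (simp add: swap_columns_def e)
  have ld: "length d = length r" using length_encode[of r] e by simp
  then show "length (swap_columns r) = length r" by (simp add: s)
  show "swap_columns (swap_columns r) = r"
    using D by (simp add: s swap_columns_def[of "decode _ _"] encode_decode)
  show "sum_list (map fst (swap_columns r)) = sum_list (map snd r)"
       "sum_list (map snd (swap_columns r)) = sum_list (map fst r)"
    using D sum_decode[OF D(2,3)] sum_decode[OF D(2), of "unmatched d - p"] by (auto simp: s)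
  show "add_column (map snd (swap_columns r)) (add_column (map fst (swap_columns r)) v)
      = add_column (map snd r) (add_column (map fst r) v)" if "length r = length v"
    using that D ld add_two_columns_decode[OF D(2,3)]
      add_two_columns_decode[OF D(2), of "unmatched d - p"] by (auto simp: s)
qed

subsection \<open>Sums over chains of partitions\<close>

text \<open>Trailing zeros are kept, so all partitions of a chain have the same number of
  rows.\<close>

definition subpartitions :: "nat list \<Rightarrow> nat list set" where
  "subpartitions l = {v. sorted_wrt (\<ge>) v \<and> list_all2 (\<le>) v l}"

lemma finite_subpartitions [simp]: "finite (subpartitions l)"
proof (rule finite_subset)
  show "subpartitions l \<subseteq> {v. set v \<subseteq> {..sum_list l} \<and> length v = length l}"
  proof (clarsimp simp: subpartitions_def list_all2_lengthD)
    fix v x assume "list_all2 (\<le>) v l" "x \<in> set v"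
    then obtain i where "i < length l" "x \<le> l ! i"
      by (metis in_set_conv_nth list_all2_conv_all_nth)
    then show "x \<le> sum_list l" by (metis le_trans elem_le_sum_list)
  qed
  show "finite {v. set v \<subseteq> {..sum_list l} \<and> length v = length l}"
    by (rule finite_lists_length_eq) simp
qed

text \<open>A sum over chains from the zero partition up to \<open>l\<close>, in which the first
  variable belongs to the outermost skew shape.\<close>

fun branching_sum :: "'a::comm_semiring_1 list \<Rightarrow> nat list \<Rightarrow> 'a" where
  "branching_sum [] l = (if \<forall>k\<in>set l. k = 0 then 1 else 0)"
| "branching_sum (x # xs) l =
     (\<Sum>v\<in>subpartitions l. x ^ sum_list (increments l v) * branching_sum xs v)"

text \<open>A partition \<open>u\<close> between \<open>v\<close> and \<open>l\<close> amounts to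
  two columns, from \<open>v\<close> to \<open>u\<close> and from \<open>u\<close> to
  \<open>l\<close>. Swapping them and adding the new first column to \<open>v\<close> is an
  involution that exchanges the exponents.\<close>

lemma two_step_symmetric:
  fixes x y :: "'a::comm_semiring_1"
  assumes "sorted_wrt (\<ge>) l"
  defines "B v \<equiv> {u. u \<in> subpartitions l \<and> v \<in> subpartitions u}"
  shows "(\<Sum>u\<in>B v. x ^ sum_list (increments l u) * y ^ sum_list (increments u v))
       = (\<Sum>u\<in>B v. y ^ sum_list (increments l u) * x ^ sum_list (increments u v))"
proof -
  define rows where "rows u = zip (increments u v) (increments l u)" for u
  define f where "f u = add_column (map fst (swap_columns (rows u))) v" for u
  have *: "f u \<in> B v \<and> f (f u) = u \<and>
      sum_list (increments l (f u)) = sum_list (increments u v) \<and>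
      sum_list (increments (f u) v) = sum_list (increments l u)" if u: "u \<in> B v" for u
  proof -
    have u': "sorted_wrt (\<ge>) u" "list_all2 (\<le>) u l" "sorted_wrt (\<ge>) v" "list_all2 (\<le>) v u"
      using u by (auto simp: B_def subpartitions_def)
    have len: "length u = length l" "length v = length l"
      using list_all2_lengthD[OF u'(2)] list_all2_lengthD[OF u'(4)] by auto
    define s where "s = swap_columns (rows u)"
    have r: "map fst (rows u) = increments u v" "map snd (rows u) = increments l u" 
        "length (rows u) = length l"
      using len by (auto simp: rows_def)
    have fu: "f u = add_column (map fst s) v" by (simp add: f_def s_def)
    have ls: "length s = length l" by (simp add: s_def length_swap_columns r)
    \<comment> \<open>The swap preserves the joint effect of both columns, so the new second column
      leads from \<open>f u\<close> to \<open>l\<close>.\<close>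
    have l: "add_column (map snd s) (f u) = l"
      using add_column_swap_columns[of "rows u" v] len u' assms(1)
      by (simp add: fu s_def r add_column_increments)
    have lfu: "length (f u) = length l" using ls len by (simp add: fu)
    have i1: "increments l (f u) = map snd s"
      using increments_add_column[of "map snd s" "f u"] l ls lfu by simp
    have i2: "increments (f u) v = map fst s"
      using increments_add_column[of "map fst s" v] ls len by (simp add: fu)
    have "rows (f u) = s" by (simp add: rows_def i1 i2 zip_map_fst_snd)
    then have "f (f u) = u"
      unfolding f_def[of "f u"] using u' by (simp add: s_def swap_columns_swap_columns r add_column_increments)
    moreover have "list_all2 (\<le>) (f u) l"
      using le_add_column[of "map snd s" "f u"] l ls lfu by simp
    moreover have "list_all2 (\<le>) v (f u)"
      using le_add_column[of "map fst s" v] ls len by (simp add: fu)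
    ultimately show ?thesis
      using u'(3) sorted_add_column[of "map fst s" v] sum_fst_swap_columns[of "rows u"]
        sum_snd_swap_columns[of "rows u"]
      by (simp add: B_def subpartitions_def i1 i2 r flip: fu s_def)
  qed
  show ?thesis
    by (rule sum.reindex_bij_witness[where i = f and j = f]) (auto simp: * mult.commute)
qed

lemma subpartitions_trans: "u \<in> subpartitions l \<Longrightarrow> v \<in> subpartitions u \<Longrightarrow> v \<in> subpartitions l"
  unfolding subpartitions_def by (auto intro: list_all2_trans[rotated] order_trans)

text \<open>Summing first over \<open>u\<close> between \<open>v\<close> and \<open>l\<close>
  isolates the two variables, since the remaining factor depends on \<open>v\<close> only.\<close>

lemma branching_sum_swap:
  assumes "sorted_wrt (\<ge>) l"
  shows "branching_sum (x # y # xs) l = branching_sum (y # x # xs) l"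
proof -
  have expand: "branching_sum (x # y # xs) l = (\<Sum>v\<in>subpartitions l.
      (\<Sum>u | u \<in> subpartitions l \<and> v \<in> subpartitions u.
        x ^ sum_list (increments l u) * y ^ sum_list (increments u v)) * branching_sum xs v)" for x y
  proof -
    have "branching_sum (x # y # xs) l = (\<Sum>u\<in>subpartitions l. \<Sum>v | v \<in> subpartitions l \<and> v \<in> subpartitions u.
        x ^ sum_list (increments l u) * y ^ sum_list (increments u v) * branching_sum xs v)"
      by (auto simp: sum_distrib_left mult.assoc intro!: sum.cong dest: subpartitions_trans)
    also have "\<dots> = (\<Sum>v\<in>subpartitions l. \<Sum>u | u \<in> subpartitions l \<and> v \<in> subpartitions u.
        x ^ sum_list (increments l u) * y ^ sum_list (increments u v) * branching_sum xs v)"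
      by (rule sum.swap_restrict) auto
    finally show ?thesis by (simp add: sum_distrib_right)
  qed
  show ?thesis unfolding expand using two_step_symmetric[OF assms, of x y] by simp
qed

lemma branching_sum_Cons_cong:
  assumes "\<And>v. sorted_wrt (\<ge>) v \<Longrightarrow> branching_sum xs v = branching_sum ys v"
  shows "branching_sum (x # xs) l = branching_sum (x # ys) l"
  using assms by (auto simp: subpartitions_def intro!: sum.cong)

lemma branching_sum_snoc:
  "sorted_wrt (\<ge>) l \<Longrightarrow> branching_sum (xs @ [x]) l = branching_sum (x # xs) l"
proof (induction xs arbitrary: l)
  case (Cons y xs)
  have "branching_sum (y # (xs @ [x])) l = branching_sum (y # (x # xs)) l"
    by (rule branching_sum_Cons_cong) (rule Cons.IH)
  with branching_sum_swap[OF Cons.prems] show ?case by simp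
qed simp

text \<open>Passage times and plane partitions produce the variables in opposite orders; this
  reconciles them.\<close>

lemma branching_sum_rev:
  "sorted_wrt (\<ge>) l \<Longrightarrow> branching_sum (rev xs) l = branching_sum xs l"
proof (induction xs arbitrary: l)
  case (Cons x xs)
  have "branching_sum (x # rev xs) l = branching_sum (x # xs) l"
    by (rule branching_sum_Cons_cong) (rule Cons.IH)
  with branching_sum_snoc[OF Cons.prems, of "rev xs" x] show ?case
    by (simp only: rev.simps)
qed simp

subsection \<open>Branching of dual Grothendieck polynomials\<close>

lemma row_part_Nil [simp]: "row_part [] k = 0"
  by (simp add: row_part_def)

lemma row_part_Cons_1 [simp]: "row_part (l # ls) (Suc 0) = l"
  by (simp add: row_part_def)

lemma row_part_Cons_Suc: "k \<ge> 1 \<Longrightarrow> row_part (l # ls) (Suc k) = row_part ls k"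
  by (auto simp: row_part_def nth_Cons')

lemma row_part_1: "row_part ls (Suc 0) = head_part ls"
  by (cases ls) auto

lemma row_part_antimono:
  assumes "sorted_wrt (\<ge>) l" "1 \<le> i" "i \<le> k"
  shows "row_part l k \<le> row_part l i"
proof (cases "i = k")
  case False
  then show ?thesis using assms sorted_wrt_nth_less[OF assms(1), of "i - 1" "k - 1"]
    by (auto simp: row_part_def)
qed simp

lemma row_part_le: "list_all2 (\<le>) v l \<Longrightarrow> row_part v k \<le> row_part l k"
  by (auto simp: row_part_def list_all2_conv_all_nth)

lemma sum_list_increments:
  "length v = length l \<Longrightarrow> sum_list (increments l v) =
     (\<Sum>k=1..length l. row_part l k - max (row_part l (Suc k)) (row_part v k))"
proof (induction l v rule: increments.induct)
  case (1 l ls v vs)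
  have "(\<Sum>k=1..length (l # ls). row_part (l # ls) k - max (row_part (l # ls) (Suc k)) (row_part (v # vs) k))
     = (\<Sum>k=0..length ls. row_part (l # ls) (Suc k) - max (row_part (l # ls) (Suc (Suc k))) (row_part (v # vs) (Suc k)))"
    by (simp add: sum.shift_bounds_cl_Suc_ivl del: sum.cl_ivl_Suc)
  also have "\<dots> = l - max (head_part ls) v +
      (\<Sum>k=1..length ls. row_part (l # ls) (Suc k) - max (row_part (l # ls) (Suc (Suc k))) (row_part (v # vs) (Suc k)))"
    by (subst sum.atLeast_Suc_atMost) (auto simp: row_part_Cons_Suc row_part_1)
  also have "\<dots> = l - max (head_part ls) v +
      (\<Sum>k=1..length ls. row_part ls k - max (row_part ls (Suc k)) (row_part vs k))"
    by (auto simp: row_part_Cons_Suc intro!: sum.cong)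
  finally show ?case using 1 by simp
qed auto

text \<open>Each column j is counted at its lowest box in \<open>l\<close>. If that lies in row k,
  then l_(k+1) < j <= l_k, and as \<open>v\<close> is weakly decreasing the column meets the skew
  shape exactly when v_k < j. This gives the interval \<open>I k\<close>.\<close>

lemma card_columns_increments:
  assumes "sorted_wrt (\<ge>) l" "v \<in> subpartitions l"
  shows "card {j. j \<ge> 1 \<and> (\<exists>i\<ge>1. row_part v i < j \<and> j \<le> row_part l i)} = sum_list (increments l v)"
proof -
  have v: "sorted_wrt (\<ge>) v" "list_all2 (\<le>) v l" using assms by (auto simp: subpartitions_def)
  define I where "I k = {max (row_part l (Suc k)) (row_part v k)<..row_part l k}" for k
  have "{j. j \<ge> 1 \<and> (\<exists>i\<ge>1. row_part v i < j \<and> j \<le> row_part l i)} = (\<Union>k\<in>{1..length l}. I k)"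
  proof (intro equalityI subsetI)
    fix j assume "j \<in> {j. j \<ge> 1 \<and> (\<exists>i\<ge>1. row_part v i < j \<and> j \<le> row_part l i)}"
    then obtain i where i: "j \<ge> 1" "i \<ge> 1" "row_part v i < j" "j \<le> row_part l i" by auto
    define S where "S = {k. k \<ge> 1 \<and> j \<le> row_part l k}"
    have S: "S \<subseteq> {1..length l}" using i(1) by (auto simp: S_def row_part_def split: if_splits)
    then have fS: "finite S" by (rule finite_subset) simp
    have iS: "i \<in> S" using i by (simp add: S_def)
    define k where "k = Max S"
    have k: "k \<in> S" "i \<le> k" using fS iS by (auto simp: k_def intro: Max_in)
    have "Suc k \<notin> S" using Max_ge[OF fS, of "Suc k"] by (auto simp: k_def)
    then have "row_part l (Suc k) < j" by (simp add: S_def)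
    moreover have "row_part v k < j"
      using row_part_antimono[OF v(1) i(2) k(2)] i(3) by simp
    ultimately have "j \<in> I k" using k by (auto simp: I_def S_def)
    with k(1) S show "j \<in> (\<Union>k\<in>{1..length l}. I k)" by blast
  qed (auto simp: I_def)
  moreover have "card (\<Union>k\<in>{1..length l}. I k) = (\<Sum>k=1..length l. card (I k))"
  proof (rule card_UN_disjoint)
    have "I i \<inter> I k = {}" if "1 \<le> i" "i < k" for i k
    proof -
      have "row_part l k \<le> row_part l (Suc i)"
        by (rule row_part_antimono[OF assms(1)]) (use that in auto)
      then show ?thesis by (auto simp: I_def)
    qed
    then show "\<forall>i\<in>{1..length l}. \<forall>k\<in>{1..length l}. i \<noteq> k \<longrightarrow> I i \<inter> I k = {}"
      by (metis Int_commute atLeastAtMost_iff linorder_neqE_nat)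
  qed (auto simp: I_def)
  ultimately show ?thesis
    using sum_list_increments[of v l] list_all2_lengthD[OF v(2)] by (simp add: I_def)
qed

text \<open>The positive entries of a row form an initial segment, so the cardinalities in
  \<open>has_shape\<close> become pointwise conditions.\<close>

lemma pp_of_shape_iff:
  "\<pi> \<in> pp_of_shape n l \<longleftrightarrow>
     (\<forall>i j. i = 0 \<or> j = 0 \<longrightarrow> \<pi> i j = 0) \<and>
     (\<forall>i\<ge>1. \<forall>j\<ge>1. \<pi> (Suc i) j \<le> \<pi> i j \<and> \<pi> i (Suc j) \<le> \<pi> i j \<and> \<pi> i j \<le> n
        \<and> (\<pi> i j > 0 \<longleftrightarrow> j \<le> row_part l i))" (is "?L = ?R")
proof
  assume L: ?L
  then have pp: "plane_partition \<pi>" and sh: "has_shape \<pi> l" by (auto simp: pp_of_shape_def)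
  have "\<pi> i j > 0 \<longleftrightarrow> j \<le> row_part l i" if ij: "i \<ge> 1" "j \<ge> 1" for i j
  proof -
    define S where "S = {j. j \<ge> 1 \<and> \<pi> i j > 0}"
    have "S \<subseteq> snd ` {(i, j). \<pi> i j \<noteq> 0}" by (force simp: S_def)
    moreover have "finite (snd ` {(i, j). \<pi> i j \<noteq> 0})"
      using pp unfolding plane_partition_def by blast
    ultimately have fin: "finite S" by (rule finite_subset)
    have card: "card S = row_part l i"
      using sh ij by (simp add: has_shape_def S_def pp_shape_def)
    have down: "j' \<in> S" if "j \<in> S" "1 \<le> j'" "j' \<le> j" for j j'
      using row_initial[OF pp ij(1), of j' j] that by (auto simp: S_def)
    have "S = {1..card S}"
    proof (cases "S = {}")
      case False
      then have "S = {1..Max S}"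
        using fin down[OF Max_in[OF fin False]] by (auto simp: S_def)
      then show ?thesis by (metis card_atLeastAtMost diff_Suc_1)
    qed simp
    then have "j \<in> S \<longleftrightarrow> j \<in> {1..row_part l i}" using card by simp
    then show ?thesis using ij by (simp add: S_def)
  qed
  with L show ?R by (simp add: pp_of_shape_def plane_partition_def)
next
  assume R: ?R
  have "{j. (k, j) \<in> pp_shape \<pi>} = {1..row_part l k}" if "k \<ge> 1" for k
    using R that by (auto simp: pp_shape_def)
  then have sh: "has_shape \<pi> l" by (simp add: has_shape_def)
  have "finite {(i, j). \<pi> i j \<noteq> 0}"
  proof (rule finite_subset)
    show "{(i, j). \<pi> i j \<noteq> 0} \<subseteq> (SIGMA i:{1..length l}. {1..row_part l i})"
    proof clarify
      fix i j assume "0 < \<pi> i j"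
      then have "i \<noteq> 0" "j \<noteq> 0" using R by (metis less_not_refl)+
      then have ij: "i \<ge> 1" "j \<ge> 1" by auto
      with R \<open>0 < \<pi> i j\<close> have "j \<le> row_part l i" by blast
      with ij show "i \<in> {1..length l} \<and> j \<in> {1..row_part l i}"
        by (auto simp: row_part_def split: if_splits)
    qed
  qed auto
  with R sh show ?L by (simp add: pp_of_shape_def plane_partition_def)
qed

text \<open>Subtracting 1 from all positive entries leaves a plane partition whose shape
  \<open>v\<close> consists of the boxes with entries above 1. The ones filled the skew shape
  between \<open>v\<close> and \<open>l\<close>, and \<open>x 1\<close> counts its columns.\<close>

lemma dual_grothendieck_Suc:
  fixes x :: "nat \<Rightarrow> 'a::comm_semiring_1"
  assumes l: "sorted_wrt (\<ge>) l"
  shows "dual_grothendieck (Suc n) l x =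
    (\<Sum>v\<in>subpartitions l. x 1 ^ sum_list (increments l v) * dual_grothendieck n v (\<lambda>i. x (Suc i)))"
proof -
  \<comment> \<open>Zeros and ones both become 0; the fixed shape \<open>l\<close> tells
    \<open>fill\<close> where the ones were.\<close>
  define strip where "strip \<pi> = (\<lambda>i j. \<pi> i j - (1::nat))" for \<pi> :: "nat \<Rightarrow> nat \<Rightarrow> nat"
  define core where "core \<pi> = map (\<lambda>i. card {j. j \<ge> 1 \<and> \<pi> i j > (1::nat)}) [1..<Suc (length l)]"
    for \<pi> :: "nat \<Rightarrow> nat \<Rightarrow> nat"
  define fill where "fill \<pi> = (\<lambda>i j. \<pi> i j + (if 1 \<le> j \<and> j \<le> row_part l i then 1 else (0::nat)))"
    for \<pi> :: "nat \<Rightarrow> nat \<Rightarrow> nat"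
  define T where "T = Sigma (subpartitions l) (pp_of_shape n)"

  have A: "(core \<pi>, strip \<pi>) \<in> T \<and> fill (strip \<pi>) = \<pi>" if "\<pi> \<in> pp_of_shape (Suc n) l" for \<pi>
  proof -
    have z: "\<pi> 0 j = 0" "\<pi> i 0 = 0" for i j using that by (auto simp: pp_of_shape_iff)
    have d: "\<pi> (Suc i) j \<le> \<pi> i j" "\<pi> i (Suc j) \<le> \<pi> i j" "\<pi> i j \<le> Suc n"
        "\<pi> i j > 0 \<longleftrightarrow> j \<le> row_part l i" if "i \<ge> 1" "j \<ge> 1" for i j
      using that \<open>\<pi> \<in> pp_of_shape (Suc n) l\<close> by (auto simp: pp_of_shape_iff)
    have row: "\<pi> i k \<le> \<pi> i j" if "i \<ge> 1" "j \<ge> 1" "j \<le> k" for i j k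
      using that(3) by (induction k rule: dec_induct) (use d(2) that in \<open>auto intro: order_trans\<close>)
    define S where "S i = {j. j \<ge> 1 \<and> \<pi> i j > 1}" for i
    have Ssub: "S i \<subseteq> {1..row_part l i}" if "i \<ge> 1" for i
      using d(4)[OF that] by (force simp: S_def)
    have S: "S i = {1..card (S i)}" if "i \<ge> 1" for i
    proof (cases "S i = {}")
      case False
      have fin: "finite (S i)" using Ssub[OF that] by (rule finite_subset) simp
      have "Max (S i) \<in> S i" using fin False by (rule Max_in)
      then have "S i = {1..Max (S i)}"
        using fin row[OF that] by (auto simp: S_def intro: less_le_trans)
      then show ?thesis by (metis card_atLeastAtMost diff_Suc_1)
    qed simp
    have cardS: "card (S i) \<le> row_part l i" if "i \<ge> 1" for i
      using card_mono[OF _ Ssub[OF that]] by simp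
    have Smono: "card (S (Suc i)) \<le> card (S i)" if "i \<ge> 1" for i
    proof (rule card_mono)
      show "finite (S i)" using Ssub[OF that] by (rule finite_subset) simp
      show "S (Suc i) \<subseteq> S i" using d(1)[OF that] by (fastforce simp: S_def)
    qed
    have core_row: "row_part (core \<pi>) i = card (S i)" if "i \<ge> 1" for i
      using cardS[OF that] that by (auto simp: row_part_def core_def S_def simp del: upt_Suc split: if_splits)
    have "sorted_wrt (\<ge>) (core \<pi>)"
    proof (subst sorted_wrt_iff_nth_Suc_transp)
      show "transp ((\<ge>) :: nat \<Rightarrow> _)" by (auto intro: transpI)
      show "\<forall>i. Suc i < length (core \<pi>) \<longrightarrow> core \<pi> ! Suc i \<le> core \<pi> ! i"
        using Smono by (auto simp: core_def S_def simp del: upt_Suc)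
    qed
    moreover have "list_all2 (\<le>) (core \<pi>) l"
    proof (rule list_all2_all_nthI)
      fix i assume "i < length (core \<pi>)"
      then show "core \<pi> ! i \<le> l ! i"
        using cardS[of "Suc i"] by (simp add: core_def S_def row_part_def del: upt_Suc)
    qed (simp add: core_def del: upt_Suc)
    moreover have "strip \<pi> \<in> pp_of_shape n (core \<pi>)"
      unfolding pp_of_shape_iff
    proof (intro conjI allI impI)
      fix i j :: nat assume ij: "1 \<le> i" "1 \<le> j"
      show "strip \<pi> (Suc i) j \<le> strip \<pi> i j" "strip \<pi> i (Suc j) \<le> strip \<pi> i j" "strip \<pi> i j \<le> n"
        using d[OF ij] by (auto simp: strip_def)
      have "0 < strip \<pi> i j \<longleftrightarrow> j \<in> S i" using ij by (auto simp: strip_def S_def)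
      also have "\<dots> \<longleftrightarrow> j \<in> {1..card (S i)}" using S[OF ij(1)] by simp
      finally show "0 < strip \<pi> i j \<longleftrightarrow> j \<le> row_part (core \<pi>) i" using ij by (simp add: core_row)
    qed (auto simp: strip_def z)
    moreover have "fill (strip \<pi>) i j = \<pi> i j" for i j
    proof (cases "i \<ge> 1 \<and> j \<ge> 1")
      case True
      then show ?thesis using d(4)[of i j] by (auto simp: fill_def strip_def)
    next
      case False
      then have "i = 0 \<or> j = 0" by auto
      then show ?thesis using z by (auto simp: fill_def strip_def row_part_def)
    qed
    ultimately show ?thesis by (auto simp: T_def subpartitions_def)
  qed

  have B: "fill \<rho> \<in> pp_of_shape (Suc n) l \<and> strip (fill \<rho>) = \<rho> \<and> core (fill \<rho>) = v \<and>
      (\<Prod>i=1..Suc n. x i ^ col_count i (fill \<rho>)) =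
      x 1 ^ sum_list (increments l v) * (\<Prod>i=1..n. x (Suc i) ^ col_count i \<rho>)"
    if v: "v \<in> subpartitions l" and \<rho>: "\<rho> \<in> pp_of_shape n v" for v \<rho>
  proof -
    have v': "sorted_wrt (\<ge>) v" "list_all2 (\<le>) v l" using v by (auto simp: subpartitions_def)
    have len: "length v = length l" using list_all2_lengthD[OF v'(2)] .
    have z: "\<rho> 0 j = 0" "\<rho> i 0 = 0" for i j using \<rho> by (auto simp: pp_of_shape_iff)
    have d: "\<rho> (Suc i) j \<le> \<rho> i j" "\<rho> i (Suc j) \<le> \<rho> i j" "\<rho> i j \<le> n"
        "\<rho> i j > 0 \<longleftrightarrow> j \<le> row_part v i" if "i \<ge> 1" "j \<ge> 1" for i j
      using that \<rho> by (auto simp: pp_of_shape_iff)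
    have vl: "row_part v i \<le> row_part l i" for i by (rule row_part_le[OF v'(2)])
    have fill1: "fill \<rho> i j = (if j \<le> row_part l i then Suc (\<rho> i j) else 0)" if "i \<ge> 1" "j \<ge> 1" for i j
      using d(4)[OF that] vl[of i] that by (auto simp: fill_def)
    have fill0: "fill \<rho> 0 j = 0" "fill \<rho> i 0 = 0" for i j
      by (auto simp: fill_def z row_part_def)
    have mem: "fill \<rho> \<in> pp_of_shape (Suc n) l"
      unfolding pp_of_shape_iff
    proof (intro conjI allI impI)
      fix i j :: nat assume ij: "1 \<le> i" "1 \<le> j"
      have "row_part l (Suc i) \<le> row_part l i" by (rule row_part_antimono[OF l ij(1)]) simp
      then show "fill \<rho> (Suc i) j \<le> fill \<rho> i j" "fill \<rho> i (Suc j) \<le> fill \<rho> i j" "fill \<rho> i j \<le> Suc n"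
          "0 < fill \<rho> i j \<longleftrightarrow> j \<le> row_part l i"
        using ij d[OF ij] by (auto simp: fill1)
    qed (auto simp: fill0)
    have strip: "strip (fill \<rho>) i j = \<rho> i j" for i j
    proof (cases "i \<ge> 1 \<and> j \<ge> 1")
      case True
      then show ?thesis using d(4)[of i j] vl[of i] by (auto simp: fill1 strip_def)
    next
      case False
      then have "i = 0 \<or> j = 0" by auto
      then show ?thesis by (auto simp: fill0 strip_def z)
    qed
    have gt1: "{j. j \<ge> 1 \<and> fill \<rho> i j > 1} = {1..row_part v i}" if "i \<ge> 1" for i
    proof (intro set_eqI)
      fix j
      show "j \<in> {j. j \<ge> 1 \<and> fill \<rho> i j > 1} \<longleftrightarrow> j \<in> {1..row_part v i}"
        using d(4)[OF that, of j] vl[of i] that by (cases "j \<ge> 1") (auto simp: fill1)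
    qed
    have core: "core (fill \<rho>) = v"
    proof (rule nth_equalityI)
      fix i assume "i < length (core (fill \<rho>))"
      then have "i < length l" by (simp add: core_def del: upt_Suc)
      then have "core (fill \<rho>) ! i = card {j. j \<ge> 1 \<and> fill \<rho> (Suc i) j > 1}"
        by (simp add: core_def del: upt_Suc)
      also have "\<dots> = row_part v (Suc i)" by (subst gt1) auto
      also have "\<dots> = v ! i" using \<open>i < length l\<close> len by (simp add: row_part_def)
      finally show "core (fill \<rho>) ! i = v ! i" .
    qed (simp add: core_def len del: upt_Suc)
    have c1: "col_count 1 (fill \<rho>) = sum_list (increments l v)"
    proof -
      \<comment> \<open>Inside \<open>l\<close> the ones of \<open>fill \<rho>\<close> come from the
        zeros of \<open>\<rho>\<close>, that is, from the boxes outside \<open>v\<close>.\<close>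
      have "fill \<rho> i j = 1 \<longleftrightarrow> row_part v i < j \<and> j \<le> row_part l i" if "i \<ge> 1" "j \<ge> 1" for i j
        using d(4)[OF that] by (auto simp: fill1[OF that])
      then have "{j. j \<ge> 1 \<and> (\<exists>i\<ge>1. fill \<rho> i j = 1)}
          = {j. j \<ge> 1 \<and> (\<exists>i\<ge>1. row_part v i < j \<and> j \<le> row_part l i)}" by blast
      then show ?thesis using card_columns_increments[OF l v] by (simp add: col_count_def)
    qed
    have c2: "col_count (Suc c) (fill \<rho>) = col_count c \<rho>" if "c \<ge> 1" for c
    proof -
      have "fill \<rho> i j = Suc c \<longleftrightarrow> \<rho> i j = c" if "i \<ge> 1" "j \<ge> 1" for i j
        using d(4)[OF that] vl[of i] \<open>c \<ge> 1\<close> by (auto simp: fill1[OF that])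
      then have "{j. j \<ge> 1 \<and> (\<exists>i\<ge>1. fill \<rho> i j = Suc c)} = {j. j \<ge> 1 \<and> (\<exists>i\<ge>1. \<rho> i j = c)}"
        by blast
      then show ?thesis by (simp add: col_count_def)
    qed
    have "(\<Prod>i=1..Suc n. x i ^ col_count i (fill \<rho>))
        = x 1 ^ col_count 1 (fill \<rho>) * (\<Prod>i=1..n. x (Suc i) ^ col_count (Suc i) (fill \<rho>))"
      by (subst prod.atLeast_Suc_atMost) (auto simp: prod.shift_bounds_cl_Suc_ivl simp del: prod.cl_ivl_Suc)
    also have "\<dots> = x 1 ^ sum_list (increments l v) * (\<Prod>i=1..n. x (Suc i) ^ col_count i \<rho>)"
      unfolding c1 by (auto simp: c2 intro!: arg_cong[where f = "(*) _"] prod.cong)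
    finally show ?thesis using mem strip core by auto
  qed

  have "dual_grothendieck (Suc n) l x = (\<Sum>(v, \<rho>)\<in>T.
      x 1 ^ sum_list (increments l v) * (\<Prod>i=1..n. x (Suc i) ^ col_count i \<rho>))"
    unfolding dual_grothendieck_def
    by (rule sum.reindex_bij_witness[where i = "\<lambda>(v, \<rho>). fill \<rho>" and j = "\<lambda>\<pi>. (core \<pi>, strip \<pi>)"])
      (use A B in \<open>force simp: T_def simp del: prod.cl_ivl_Suc\<close>)+
  also have "\<dots> = (\<Sum>v\<in>subpartitions l. x 1 ^ sum_list (increments l v)
      * dual_grothendieck n v (\<lambda>i. x (Suc i)))"
    unfolding T_def dual_grothendieck_def sum_distrib_left
    by (rule sum.Sigma[symmetric]) (auto simp: finite_pp_of_shape)
  finally show ?thesis .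
qed

lemma dual_grothendieck_0: "dual_grothendieck 0 l x = branching_sum [] l"
proof (cases "\<forall>k\<in>set l. k = 0")
  case True
  then have r: "row_part l i = 0" for i by (auto simp: row_part_def)
  have "pp_of_shape 0 l = {\<lambda>_ _. 0}"
  proof (intro equalityI subsetI)
    fix \<pi> assume \<pi>: "\<pi> \<in> pp_of_shape 0 l"
    have "\<pi> i j = 0" for i j
      using \<pi> by (cases "i = 0 \<or> j = 0") (auto simp: pp_of_shape_iff)
    then show "\<pi> \<in> {\<lambda>_ _. 0}" by auto
  qed (auto simp: pp_of_shape_iff r)
  with True show ?thesis by (simp add: dual_grothendieck_def)
next
  case False
  then obtain i where i: "i < length l" "l ! i \<noteq> 0" by (metis in_set_conv_nth)
  have "\<pi> \<notin> pp_of_shape 0 l" for \<pi>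
  proof
    assume "\<pi> \<in> pp_of_shape 0 l"
    then have "\<pi> (Suc i) 1 \<le> 0" "\<pi> (Suc i) 1 > 0 \<longleftrightarrow> 1 \<le> row_part l (Suc i)"
      by (simp_all only: pp_of_shape_iff)
    with i show False by (simp add: row_part_def)
  qed
  then have "pp_of_shape 0 l = {}" by blast
  with False show ?thesis by (simp add: dual_grothendieck_def)
qed

lemma dual_grothendieck_eq_branching_sum:
  "sorted_wrt (\<ge>) l \<Longrightarrow> dual_grothendieck n l x = branching_sum (map x [1..<Suc n]) l"
proof (induction n arbitrary: l x)
  case 0
  then show ?case by (simp add: dual_grothendieck_0)
next
  case (Suc n)
  have "map x [1..<Suc (Suc n)] = x 1 # map (\<lambda>i. x (Suc i)) [1..<Suc n]"
    by (simp add: upt_conv_Cons map_Suc_upt[symmetric] del: upt_Suc)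
  moreover have "dual_grothendieck (Suc n) l x = (\<Sum>v\<in>subpartitions l.
      x 1 ^ sum_list (increments l v) * branching_sum (map (\<lambda>i. x (Suc i)) [1..<Suc n]) v)"
    unfolding dual_grothendieck_Suc[OF Suc.prems]
    by (intro sum.cong) (auto simp: subpartitions_def Suc.IH simp del: upt_Suc)
  ultimately show ?case by simp
qed

subsection \<open>Last-passage times\<close>

text \<open>The recursion for last-passage times. The value 0 in row and column 0 is harmless
  because weights are nonnegative.\<close>

fun passage_time :: "(nat \<Rightarrow> nat \<Rightarrow> nat) \<Rightarrow> nat \<Rightarrow> nat \<Rightarrow> nat" where
  "passage_time w (Suc a) (Suc b) =
     w (Suc a) (Suc b) + max (passage_time w a (Suc b)) (passage_time w (Suc a) b)"
| "passage_time w _ _ = 0"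

lemma path_weight_le_passage_time:
  assumes "P \<noteq> []" "hd P = (1, 1)" "successively lattice_step P"
  shows "(\<Sum>(i, j)\<leftarrow>P. w i j) \<le> passage_time w (fst (last P)) (snd (last P)) \<and>
    fst (last P) \<ge> 1 \<and> snd (last P) \<ge> 1"
  using assms
proof (induction P rule: rev_nonempty_induct)
  case (single x)
  then show ?case by simp
next
  case (snoc x P)
  obtain a b where ab: "last P = (a, b)" by (cases "last P")
  have s: "successively lattice_step P" and st: "lattice_step (last P) x"
    using snoc.prems snoc.hyps by (auto simp: successively_append_iff)
  have "hd P = (1, 1)" using snoc by simp
  from snoc.IH[OF this s] have IH: "(\<Sum>(i, j)\<leftarrow>P. w i j) \<le> passage_time w a b" "a \<ge> 1" "b \<ge> 1"
    by (auto simp: ab)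
  then obtain a' b' where "a = Suc a'" "b = Suc b'" by (metis Suc_le_D One_nat_def)
  with IH st show ?case by (auto simp: lattice_step_def ab max_def)
qed

text \<open>A maximal path is traced backwards through the larger of the two neighbours.\<close>

lemma passage_time_attained:
  assumes "a \<ge> 1" "b \<ge> 1"
  shows "\<exists>P\<in>lattice_paths (1, 1) (a, b). (\<Sum>(i, j)\<leftarrow>P. w i j) = passage_time w a b"
  using assms
proof (induction w a b rule: passage_time.induct)
  case (1 w a b)
  have extend: "\<exists>P\<in>lattice_paths (1, 1) (Suc a, Suc b). (\<Sum>(i, j)\<leftarrow>P. w i j) = w (Suc a) (Suc b) + c"
    if "P \<in> lattice_paths (1, 1) r" "lattice_step r (Suc a, Suc b)" "(\<Sum>(i, j)\<leftarrow>P. w i j) = c" for P r c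
    by (rule bexI[of _ "P @ [(Suc a, Suc b)]"])
      (use that in \<open>auto simp: lattice_paths_def successively_append_iff\<close>)
  \<comment> \<open>In the first row or column one neighbour has index 0 and time 0, so the other
    attains the maximum.\<close>
  consider "a = 0 \<and> b = 0" | "a \<ge> 1" "passage_time w (Suc a) b \<le> passage_time w a (Suc b)"
    | "b \<ge> 1" "passage_time w a (Suc b) \<le> passage_time w (Suc a) b"
    by (cases a; cases b) (auto simp del: passage_time.simps(1), linarith)
  then show ?case
  proof cases
    case 1
    then have "[(1, 1)] \<in> lattice_paths (1, 1) (Suc a, Suc b)" by (simp add: lattice_paths_def)
    with 1 show ?thesis by (force intro: bexI[of _ "[(1, 1)]"])
  next
    case 2
    then obtain P where "P \<in> lattice_paths (1, 1) (a, Suc b)" "(\<Sum>(i, j)\<leftarrow>P. w i j) = passage_time w a (Suc b)"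
      using "1.IH"(1) by auto
    from extend[OF this(1) _ this(2)] 2 show ?thesis by (simp add: lattice_step_def max_def)
  next
    case 3
    then obtain P where "P \<in> lattice_paths (1, 1) (Suc a, b)" "(\<Sum>(i, j)\<leftarrow>P. w i j) = passage_time w (Suc a) b"
      using "1.IH"(2) by auto
    from extend[OF this(1) _ this(2)] 3 show ?thesis by (simp add: lattice_step_def max_absorb2)
  qed
qed auto

lemma last_passage_eq_passage_time:
  assumes "a \<ge> 1" "b \<ge> 1"
  shows "last_passage w a b = passage_time w a b"
  unfolding last_passage_def
proof (rule Max_eqI)
  show "finite ((\<lambda>P. \<Sum>(i, j)\<leftarrow>P. w i j) ` lattice_paths (1, 1) (a, b))"
    by (simp add: finite_lattice_paths)
  show "passage_time w a b \<in> (\<lambda>P. \<Sum>(i, j)\<leftarrow>P. w i j) ` lattice_paths (1, 1) (a, b)"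
    using passage_time_attained[OF assms, of w] by force
  show "c \<le> passage_time w a b" if "c \<in> (\<lambda>P. \<Sum>(i, j)\<leftarrow>P. w i j) ` lattice_paths (1, 1) (a, b)" for c
    using that path_weight_le_passage_time[of _ w] by (force simp: lattice_paths_def)
qed

section \<open>Passage times column by column, last row first\<close>

primrec column_list :: "(nat \<Rightarrow> nat) \<Rightarrow> nat \<Rightarrow> nat list" where
  "column_list f 0 = []"
| "column_list f (Suc i) = f (Suc i) # column_list f i"

lemma length_column_list [simp]: "length (column_list f m) = m"
  by (induction m) auto

lemma column_list_eq_iff:
  "length l = m \<Longrightarrow> column_list f m = l \<longleftrightarrow> (\<forall>k\<in>{1..m}. f (m + 1 - k) = row_part l k)"
proof (induction m arbitrary: l)
  case (Suc m)
  then obtain a l' where l: "l = a # l'" "length l' = m" by (cases l) auto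
  have "(\<forall>k\<in>{1..Suc m}. P k) \<longleftrightarrow> P 1 \<and> (\<forall>k\<in>{1..m}. P (Suc k))" for P
  proof -
    have *: "{1..Suc m} = insert 1 (Suc ` {1..m})" by (auto simp: image_Suc_atLeastAtMost)
    show ?thesis unfolding * by (simp del: image_Suc_atLeastAtMost)
  qed
  then show ?case using Suc.IH[OF l(2)] by (auto simp: l row_part_Cons_Suc)
qed auto

lemma column_passage_time_Suc:
  "column_list (\<lambda>i. passage_time w i (Suc k)) m =
     add_column (column_list (\<lambda>i. w i (Suc k)) m) (column_list (\<lambda>i. passage_time w i k) m)"
proof (induction m)
  case (Suc m)
  have "head_part (column_list (\<lambda>i. passage_time w i (Suc k)) m) = passage_time w m (Suc k)"
    by (cases m) auto
  then show ?case by (simp flip: Suc.IH)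
qed simp

lemma column_list_zero: "column_list (\<lambda>_. 0) m = replicate m 0"
  by (induction m) auto

lemma add_column_eq_iff:
  assumes "length w = length v" "sorted_wrt (\<ge>) l"
  shows "add_column w v = l \<longleftrightarrow> list_all2 (\<le>) v l \<and> w = increments l v"
  using assms le_add_column[of w v] increments_add_column[of w v] add_column_increments[of v l]
  by auto

lemma sorted_column_passage_time: "sorted_wrt (\<ge>) (column_list (\<lambda>i. passage_time w i k) m)"
proof (cases k)
  case 0
  have "sorted_wrt (\<ge>) (replicate m (0::nat))" by (induction m) auto
  with 0 show ?thesis by (simp add: column_list_zero)
qed (simp add: column_passage_time_Suc sorted_add_column)

text \<open>Given the partition \<open>v\<close> at column \<open>k\<close>, the weights of the next
  column are forced. This splits the event according to \<open>v\<close>.\<close>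

lemma column_passage_time_Suc_eq_iff:
  assumes "length l = m" "sorted_wrt (\<ge>) l"
  shows "column_list (\<lambda>i. passage_time w i (Suc k)) m = l \<longleftrightarrow>
    (\<exists>v\<in>subpartitions l. column_list (\<lambda>i. passage_time w i k) m = v \<and>
       column_list (\<lambda>i. w i (Suc k)) m = increments l v)"
  unfolding column_passage_time_Suc
  by (subst add_column_eq_iff)
    (use assms in \<open>auto simp: subpartitions_def sorted_column_passage_time\<close>)

lemma prod_power_row_part:
  "(\<Prod>i=1..length l. (x::'a::comm_semiring_1) ^ row_part l (length l + 1 - i)) = x ^ sum_list l"
proof (induction l)
  case (Cons a l)
  have "(\<Prod>i=1..length (a # l). x ^ row_part (a # l) (length (a # l) + 1 - i))
    = (\<Prod>i=1..length l. x ^ row_part (a # l) (Suc (length l + 1 - i))) * x ^ a"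
    by (simp add: Suc_diff_le)
  also have "\<dots> = (\<Prod>i=1..length l. x ^ row_part l (length l + 1 - i)) * x ^ a"
    by (intro arg_cong2[where f = "(*)"] prod.cong refl) (subst row_part_Cons_Suc, auto)
  finally show ?case using Cons.IH by (simp add: power_add mult.commute)
qed simp

section \<open>Measurability and the law of the passage times\<close>

lemma measurable_count_space_binary:
  fixes f g :: "'a \<Rightarrow> nat"
  assumes "f \<in> measurable M (count_space UNIV)" "g \<in> measurable M (count_space UNIV)"
  shows "(\<lambda>\<omega>. h (f \<omega>) (g \<omega>)) \<in> measurable M (count_space UNIV)"
  by (rule measurable_compose_countable[OF _ assms(1)])
    (rule measurable_compose[OF assms(2)], simp)

lemma measurable_passage_time:
  assumes "\<And>i j. i \<ge> 1 \<Longrightarrow> j \<ge> 1 \<Longrightarrow> W i j \<in> measurable M (count_space UNIV)"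
  shows "(\<lambda>\<omega>. passage_time (\<lambda>i j. W i j \<omega>) a b) \<in> measurable M (count_space UNIV)"
\<comment> \<open>The predicate ignores the matrix argument of the rule, since here the matrix
  varies with \<omega>.\<close>
proof (induction a b rule: passage_time.induct[of "\<lambda>_ a b. Q a b" for Q, case_names step])
  case (step _ a b)
  have "(\<lambda>\<omega>. max (passage_time (\<lambda>i j. W i j \<omega>) a (Suc b)) (passage_time (\<lambda>i j. W i j \<omega>) (Suc a) b))
      \<in> measurable M (count_space UNIV)"
    by (rule measurable_count_space_binary[where h = max]) (fact step.IH)+
  moreover have "W (Suc a) (Suc b) \<in> measurable M (count_space UNIV)" by (rule assms) auto
  ultimately show ?case
    unfolding passage_time.simps by (intro measurable_count_space_binary[where h = "(+)"])
qed auto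

text \<open>
  Prescribing the weights of the columns not yet used keeps the induction on \<open>k\<close> free of any
  independence argument beyond the product formula at \<open>k = 0\<close>.
\<close>

lemma (in prob_space) passage_time_law:
  fixes W :: "nat \<Rightarrow> nat \<Rightarrow> 'a \<Rightarrow> nat" and q :: "nat \<Rightarrow> real"
  assumes "m \<ge> 1" "n \<ge> 1"
    and indep: "indep_vars (\<lambda>_. count_space UNIV) (\<lambda>(i, j). W i j) ({1..} \<times> {1..})"
    and law: "\<And>i j k. i \<ge> 1 \<Longrightarrow> j \<in> {1..n} \<Longrightarrow>
           prob {\<omega> \<in> space M. W i j \<omega> = k} = (1 - q j) * q j ^ k"
    and "k \<le> n" "length l = m" "sorted_wrt (\<ge>) l"
  shows "prob {\<omega> \<in> space M. column_list (\<lambda>i. passage_time (\<lambda>i j. W i j \<omega>) i k) m = l \<and>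
            (\<forall>i\<in>{1..m}. \<forall>j\<in>{k<..n}. W i j \<omega> = f i j)}
    = (\<Prod>j=1..n. (1 - q j) ^ m) * branching_sum (rev (map q [1..<Suc k])) l *
      (\<Prod>j\<in>{k<..n}. \<Prod>i=1..m. q j ^ f i j)"
proof -
  have measW: "W i j \<in> measurable M (count_space UNIV)" if "i \<ge> 1" "j \<ge> 1" for i j
  proof -
    have "(\<lambda>(i, j). W i j) (i, j) \<in> measurable M (count_space UNIV)"
      using indep that unfolding indep_vars_def2 by blast
    then show ?thesis by simp
  qed
  have ev: "{\<omega> \<in> space M. X \<omega> = c} \<in> events" if "X \<in> measurable M (count_space UNIV)"
    for X :: "'a \<Rightarrow> nat" and c
  proof -
    have "{\<omega> \<in> space M. X \<omega> = c} = X -` {c} \<inter> space M" by auto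
    then show ?thesis using measurable_sets[OF that, of "{c}"] by simp
  qed
  have all: "{\<omega> \<in> space M. \<forall>s\<in>S. P s \<omega>} \<in> events"
    if "finite S" "\<And>s. s \<in> S \<Longrightarrow> {\<omega> \<in> space M. P s \<omega>} \<in> events" for S :: "nat set" and P
    by (cases "S = {}") (use that in \<open>auto intro!: sets.sets_Collect_finite_All'\<close>)
  show ?thesis using assms(5-7)
  proof (induction k arbitrary: l f)
    \<comment> \<open>Before any column is used the partition is zero and all weights are
      prescribed, so independence gives the probability.\<close>
    case 0
    have "prob {\<omega> \<in> space M. \<forall>i\<in>{1..m}. \<forall>j\<in>{1..n}. W i j \<omega> = f i j}
      = (\<Prod>j=1..n. \<Prod>i=1..m. (1 - q j) * q j ^ f i j)"
    proof -
      define I where "I = {1..m} \<times> {1..n}"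
      have "prob (\<Inter>p\<in>I. (\<lambda>(i, j). W i j) p -` {f (fst p) (snd p)} \<inter> space M)
          = (\<Prod>p\<in>I. prob ((\<lambda>(i, j). W i j) p -` {f (fst p) (snd p)} \<inter> space M))"
        using assms(1,2) by (intro indep_varsD[OF indep]) (auto simp: I_def)
      moreover have "(\<Inter>p\<in>I. (\<lambda>(i, j). W i j) p -` {f (fst p) (snd p)} \<inter> space M)
          = {\<omega> \<in> space M. \<forall>i\<in>{1..m}. \<forall>j\<in>{1..n}. W i j \<omega> = f i j}"
      proof -
        \<comment> \<open>A nonempty index set keeps the intersection inside
          \<open>space M\<close>.\<close>
        have "(1, 1) \<in> I" using assms(1,2) by (simp add: I_def)
        then show ?thesis by (auto simp: I_def)
      qed
      moreover have "(\<Prod>p\<in>I. prob ((\<lambda>(i, j). W i j) p -` {f (fst p) (snd p)} \<inter> space M))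
          = (\<Prod>(i, j)\<in>I. (1 - q j) * q j ^ f i j)"
      proof (rule prod.cong)
        fix p assume "p \<in> I"
        obtain i j where p: "p = (i, j)" by (cases p)
        have "prob {\<omega> \<in> space M. W i j \<omega> = f i j} = (1 - q j) * q j ^ f i j"
          using \<open>p \<in> I\<close> by (intro law) (auto simp: I_def p)
        moreover have "W i j -` {f i j} \<inter> space M = {\<omega> \<in> space M. W i j \<omega> = f i j}" by auto
        ultimately show "prob ((\<lambda>(i, j). W i j) p -` {f (fst p) (snd p)} \<inter> space M)
            = (case p of (i, j) \<Rightarrow> (1 - q j) * q j ^ f i j)" by (simp add: p)
      qed simp
      moreover have "(\<Prod>(i, j)\<in>I. (1 - q j) * q j ^ f i j) = (\<Prod>j=1..n. \<Prod>i=1..m. (1 - q j) * q j ^ f i j)"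
        unfolding I_def prod.cartesian_product[symmetric] by (rule prod.swap)
      ultimately show ?thesis by simp
    qed
    moreover have "{0<..n} = {1..n}" by auto
    moreover have "replicate m 0 = l \<longleftrightarrow> (\<forall>c\<in>set l. c = 0)"
      using 0 by (metis in_set_replicate replicate_eqI)
    ultimately show ?case
      by (cases "\<forall>c\<in>set l. c = 0") (auto simp: column_list_zero prod.distrib)
  next
    case (Suc k)
    \<comment> \<open>Column \<open>Suc k\<close> receives the weights leading from \<open>v\<close>
      to \<open>l\<close>, with mirrored index because \<open>increments\<close> lists the last row
      first.\<close>
    define g where "g v = (\<lambda>i j. if j = Suc k then row_part (increments l v) (m + 1 - i) else f i j)" for v
    define E where "E v = {\<omega> \<in> space M. column_list (\<lambda>i. passage_time (\<lambda>i j. W i j \<omega>) i k) m = v \<and>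
              (\<forall>i\<in>{1..m}. \<forall>j\<in>{k<..n}. W i j \<omega> = g v i j)}" for v
    define D where "D = (\<Prod>j=1..n. (1 - q j) ^ m)"
    have ivl: "{k<..n} = insert (Suc k) {Suc k<..n}" using Suc.prems by auto
    have len: "length (increments l v) = m" "length v = m" "sorted_wrt (\<ge>) v" if "v \<in> subpartitions l" for v
      using that Suc.prems by (auto simp: subpartitions_def dest: list_all2_lengthD)
    have col: "column_list (\<lambda>i. w i (Suc k)) m = increments l v \<longleftrightarrow>
        (\<forall>i\<in>{1..m}. w i (Suc k) = g v i (Suc k))" if "v \<in> subpartitions l" for v and w :: "nat \<Rightarrow> nat \<Rightarrow> nat"
    proof -
      have mirror: "m + 1 - i \<in> {1..m}" and mirror_mirror: "m + 1 - (m + 1 - i) = i" if "i \<in> {1..m}" for i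
        using that by auto
      have "(\<forall>i\<in>{1..m}. w (m + 1 - i) (Suc k) = row_part (increments l v) i) \<longleftrightarrow>
          (\<forall>i\<in>{1..m}. w i (Suc k) = row_part (increments l v) (m + 1 - i))" (is "?L = ?R")
      proof (intro iffI ballI)
        fix i assume i: "i \<in> {1..m}" and L: ?L
        show "w i (Suc k) = row_part (increments l v) (m + 1 - i)"
          using bspec[OF L mirror[OF i]] mirror_mirror[OF i] by simp
      next
        fix i assume i: "i \<in> {1..m}" and R: ?R
        show "w (m + 1 - i) (Suc k) = row_part (increments l v) i"
          using bspec[OF R mirror[OF i]] mirror_mirror[OF i] by simp
      qed
      then show ?thesis using column_list_eq_iff[OF len(1)[OF that], of "\<lambda>i. w i (Suc k)"]
        by (simp add: g_def)
    qed
    have "{\<omega> \<in> space M. column_list (\<lambda>i. passage_time (\<lambda>i j. W i j \<omega>) i (Suc k)) m = l \<and>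
              (\<forall>i\<in>{1..m}. \<forall>j\<in>{Suc k<..n}. W i j \<omega> = f i j)} = (\<Union>v\<in>subpartitions l. E v)"
    proof -
      have "(\<forall>i\<in>{1..m}. \<forall>j\<in>{k<..n}. w i j = g v i j) \<longleftrightarrow>
          (\<forall>i\<in>{1..m}. w i (Suc k) = g v i (Suc k)) \<and> (\<forall>i\<in>{1..m}. \<forall>j\<in>{Suc k<..n}. w i j = f i j)"
        for v and w :: "nat \<Rightarrow> nat \<Rightarrow> nat"
        unfolding ivl by (auto simp: g_def)
      then have key: "column_list (\<lambda>i. W i (Suc k) \<omega>) m = increments l v \<and>
            (\<forall>i\<in>{1..m}. \<forall>j\<in>{Suc k<..n}. W i j \<omega> = f i j) \<longleftrightarrow>
          (\<forall>i\<in>{1..m}. \<forall>j\<in>{k<..n}. W i j \<omega> = g v i j)" if "v \<in> subpartitions l" for v \<omega>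
        using col[OF that, of "\<lambda>i j. W i j \<omega>"] by simp
      have "\<omega> \<in> E v \<longleftrightarrow> \<omega> \<in> space M \<and> column_list (\<lambda>i. passage_time (\<lambda>i j. W i j \<omega>) i k) m = v \<and>
          column_list (\<lambda>i. W i (Suc k) \<omega>) m = increments l v \<and>
          (\<forall>i\<in>{1..m}. \<forall>j\<in>{Suc k<..n}. W i j \<omega> = f i j)" if "v \<in> subpartitions l" for v \<omega>
        unfolding E_def mem_Collect_eq key[OF that, symmetric] ..
      then show ?thesis
        by (simp add: set_eq_iff column_passage_time_Suc_eq_iff[OF Suc.prems(2,3)] cong: bex_cong)
    qed
    moreover have "prob (\<Union>v\<in>subpartitions l. E v) = (\<Sum>v\<in>subpartitions l. prob (E v))"
    proof (rule finite_measure_finite_Union)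
      show "disjoint_family_on E (subpartitions l)" by (auto simp: disjoint_family_on_def E_def)
      show "E ` subpartitions l \<subseteq> events"
      proof clarify
        fix v assume v: "v \<in> subpartitions l"
        show "E v \<in> events"
          unfolding E_def column_list_eq_iff[OF len(2)[OF v]]
          by (intro sets.sets_Collect_conj all ev
            measurable_passage_time measW) auto
      qed
    qed simp
    moreover have "prob (E v) = D * (q (Suc k) ^ sum_list (increments l v) *
        branching_sum (rev (map q [1..<Suc k])) v) * (\<Prod>j\<in>{Suc k<..n}. \<Prod>i=1..m. q j ^ f i j)"
      if v: "v \<in> subpartitions l" for v
    proof -
      have "prob (E v) = D * branching_sum (rev (map q [1..<Suc k])) v *
          (\<Prod>j\<in>{k<..n}. \<Prod>i=1..m. q j ^ g v i j)"
        unfolding E_def D_def using Suc.prems len[OF v] by (intro Suc.IH) auto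
      moreover have "(\<Prod>j\<in>{k<..n}. \<Prod>i=1..m. q j ^ g v i j) =
          (\<Prod>i=1..m. q (Suc k) ^ row_part (increments l v) (m + 1 - i)) *
          (\<Prod>j\<in>{Suc k<..n}. \<Prod>i=1..m. q j ^ f i j)"
        unfolding ivl by (auto simp: g_def intro!: arg_cong2[where f = "(*)"] prod.cong)
      moreover have "(\<Prod>i=1..m. q (Suc k) ^ row_part (increments l v) (m + 1 - i))
          = q (Suc k) ^ sum_list (increments l v)"
        using prod_power_row_part[of "q (Suc k)" "increments l v"] by (simp only: len(1)[OF v])
      ultimately show ?thesis by (simp only: mult_ac)
    qed
    \<comment> \<open>The newest variable goes in front, as it belongs to the outermost skew
      shape.\<close>
    moreover have "rev (map q [1..<Suc (Suc k)]) = q (Suc k) # rev (map q [1..<Suc k])" by simp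
    ultimately show ?case
      by (simp add: D_def sum_distrib_left sum_distrib_right mult_ac del: upt_Suc)
  qed
qed

theorem theorem1p1:
  fixes M :: "'a measure"
    and W :: "nat \<Rightarrow> nat \<Rightarrow> 'a \<Rightarrow> nat"
    and q :: "nat \<Rightarrow> real"
    and m n :: nat
    and lam :: "nat list"
  assumes "prob_space M"
    and "m \<ge> 1" and "n \<ge> 1"
    and "\<And>j. j \<in> {1..n} \<Longrightarrow> 0 < q j \<and> q j < 1"
    and "prob_space.indep_vars M (\<lambda>_. count_space UNIV) (\<lambda>(i, j). W i j) ({1..} \<times> {1..})"
    and "\<And>i j k. i \<ge> 1 \<Longrightarrow> j \<in> {1..n} \<Longrightarrow>
           measure M {\<omega> \<in> space M. W i j \<omega> = k} = (1 - q j) * q j ^ k"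
    and "length lam = m" and "sorted_wrt (\<ge>) lam"
  shows "measure M {\<omega> \<in> space M. \<forall>k\<in>{1..m}.
             last_passage (\<lambda>i j. W i j \<omega>) (m + 1 - k) n = row_part lam k}
         = (\<Prod>i=1..n. (1 - q i) ^ m) * dual_grothendieck n lam q"
proof -
  interpret prob_space M by fact
  have "{\<omega> \<in> space M. \<forall>k\<in>{1..m}. last_passage (\<lambda>i j. W i j \<omega>) (m + 1 - k) n = row_part lam k}
    = {\<omega> \<in> space M. column_list (\<lambda>i. passage_time (\<lambda>i j. W i j \<omega>) i n) m = lam}"
  proof -
    have "last_passage w (m + 1 - k) n = passage_time w (m + 1 - k) n" if "k \<in> {1..m}" for w k
      using that assms(3) by (intro last_passage_eq_passage_time) auto
    then show ?thesis by (simp add: column_list_eq_iff[OF assms(7)])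
  qed
  \<comment> \<open>At \<open>k = n\<close> no column is left to prescribe, so the last product is
    empty for any choice of \<open>f\<close>, here 0. Then \<open>branching_sum_rev\<close> restores
    the order of the variables.\<close>
  then show ?thesis
    using passage_time_law[OF assms(2,3,5,6) order_refl assms(7,8), of "\<lambda>_ _. 0"]
    by (simp add: branching_sum_rev[OF assms(8)] dual_grothendieck_eq_branching_sum[OF assms(8)]
      del: upt_Suc)
qed

end
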